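(* Let $H$ be a finitely generated group of polynomial growth, and consider its Cayley graph with respect to a finite generating set, with edge set $E$. Then there are no non-constant harmonic functions $f: H \to \mathbb{R}$ with gradient $\nabla f$ in $c_0(E)$.
   Context: The Cayley graph of $H$ for a finite generating set $S$ has vertex set $H$ and edge set $E = \{(x,y) : x^{-1}y\in S\cup S^{-1}\}$. The gradient of $f: H \to \mathbb{R}$ is $\nabla f: E\to\mathbb{R}$, $\nabla f(x,y) = f(y)-f(x)$. A function $f$ is harmonic if $\nabla^*\nabla f = 0$, i.e. its value at each vertex is the average of its values at the neighbours. For a countable set $Y$, $c_0(Y)$ is the closure of the finitely supported functions in $\ell^\infty(Y)$, i.e. the functions $g: Y\to\mathbb{R}$ such that for every $\epsilon>0$ there is a finite $F\subset Y$ with $\|g\|_{\ell^\infty(Y\setminus F)} < \epsilon$. *)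

theory Defs
  imports "HOL-Analysis.Analysis" "HOL-Algebra.Generated_Groups"
begin

section \<open>Generating sets, growth and Cayley graphs\<close>

definition finite_generating_set :: "('a, 'b) monoid_scheme \<Rightarrow> 'a set \<Rightarrow> bool"
  where "finite_generating_set G S \<longleftrightarrow>
    finite S \<and> S \<subseteq> carrier G \<and> generate G S = carrier G"

definition symmetrized :: "('a, 'b) monoid_scheme \<Rightarrow> 'a set \<Rightarrow> 'a set"
  where "symmetrized G S = S \<union> m_inv G ` S"

definition cayley_edges :: "('a, 'b) monoid_scheme \<Rightarrow> 'a set \<Rightarrow> ('a \<times> 'a) set"
  where "cayley_edges G S =
    {(x, y). x \<in> carrier G \<and> y \<in> carrier G \<and> inv\<^bsub>G\<^esub> x \<otimes>\<^bsub>G\<^esub> y \<in> symmetrized G S}"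

text \<open>The elements of word length at most \<open>n\<close>, i.e. the ball of radius \<open>n\<close> about the
  identity in the Cayley graph.\<close>

primrec word_ball :: "('a, 'b) monoid_scheme \<Rightarrow> 'a set \<Rightarrow> nat \<Rightarrow> 'a set"
  where
    "word_ball G S 0 = {\<one>\<^bsub>G\<^esub>}"
  | "word_ball G S (Suc n) = word_ball G S n \<union> (word_ball G S n <#>\<^bsub>G\<^esub> symmetrized G S)"

text \<open>Polynomial growth does not depend on the generating set, so it is stated as a property of
  the group: some finite generating set exists and has polynomially growing balls.\<close>

definition polynomial_growth :: "('a, 'b) monoid_scheme \<Rightarrow> bool"
  where "polynomial_growth G \<longleftrightarrow>
    (\<exists>S. finite_generating_set G S \<and>
      (\<exists>(C::real) (d::nat). \<forall>n\<ge>1. real (card (word_ball G S n)) \<le> C * real n ^ d))"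

section \<open>Gradient and harmonic functions\<close>

definition gradient :: "('a \<Rightarrow> real) \<Rightarrow> 'a \<times> 'a \<Rightarrow> real"
  where "gradient f = (\<lambda>(x, y). f y - f x)"

text \<open>The formal adjoint of the gradient on a locally finite graph with set \<open>E\<close> of directed
  edges; see \<open>gradient_adjoint\<close> below.\<close>

definition gradient_adj :: "('a \<times> 'a) set \<Rightarrow> ('a \<times> 'a \<Rightarrow> real) \<Rightarrow> 'a \<Rightarrow> real"
  where "gradient_adj E g x = (\<Sum>y | (y, x) \<in> E. g (y, x)) - (\<Sum>y | (x, y) \<in> E. g (x, y))"

definition harmonic :: "'a set \<Rightarrow> ('a \<times> 'a) set \<Rightarrow> ('a \<Rightarrow> real) \<Rightarrow> bool"
  where "harmonic V E f \<longleftrightarrow> (\<forall>x\<in>V. gradient_adj E (gradient f) x = 0)"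

section \<open>Functions vanishing at infinity\<close>

text \<open>With values in \<open>ennreal\<close>, the supremum over the empty set is \<open>0\<close> and the supremum of an
  unbounded function is infinite.\<close>

definition linf_norm :: "'a set \<Rightarrow> ('a \<Rightarrow> real) \<Rightarrow> ennreal"
  where "linf_norm Y g = (SUP y\<in>Y. ennreal \<bar>g y\<bar>)"

definition c0 :: "'a set \<Rightarrow> ('a \<Rightarrow> real) set"
  where "c0 Y = {g. \<forall>\<epsilon>>0. \<exists>F. finite F \<and> F \<subseteq> Y \<and> linf_norm (Y - F) g < ennreal \<epsilon>}"

section \<open>Basic properties\<close>

lemma gradient_adjoint:
  assumes E: "E \<subseteq> V \<times> V"
    and fin: "\<And>x. finite {y. (x, y) \<in> E}" "\<And>x. finite {y. (y, x) \<in> E}"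
    and f: "finite {x \<in> V. f x \<noteq> 0}"
  shows "(\<Sum>\<^sub>\<infinity>e\<in>E. gradient f e * g e) = (\<Sum>\<^sub>\<infinity>x\<in>V. f x * gradient_adj E g x)"
proof -
  define A where "A = {x \<in> V. f x \<noteq> 0}"
  have A: "finite A" using f by (simp add: A_def)
  define I where "I = {e \<in> E. snd e \<in> A}"
  define J where "J = {e \<in> E. fst e \<in> A}"
  have I: "I = (\<lambda>(x, y). (y, x)) ` (SIGMA x:A. {y. (y, x) \<in> E})"
    by (force simp: I_def)
  have J: "J = (SIGMA x:A. {y. (x, y) \<in> E})"
    by (force simp: J_def)
  have finI: "finite I" unfolding I by (intro finite_imageI finite_SigmaI A fin)
  have finJ: "finite J" unfolding J by (intro finite_SigmaI A fin)
  have "(\<Sum>\<^sub>\<infinity>e\<in>E. gradient f e * g e) = (\<Sum>\<^sub>\<infinity>e\<in>I \<union> J. gradient f e * g e)"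
    by (rule infsum_cong_neutral) (use E in \<open>auto simp: I_def J_def A_def gradient_def\<close>)
  also have "\<dots> = (\<Sum>e\<in>I \<union> J. gradient f e * g e)"
    using finI finJ by simp
  also have "\<dots> = (\<Sum>e\<in>I \<union> J. f (snd e) * g e) - (\<Sum>e\<in>I \<union> J. f (fst e) * g e)"
    by (simp add: gradient_def case_prod_beta sum_subtractf left_diff_distrib)
  also have "(\<Sum>e\<in>I \<union> J. f (snd e) * g e) = (\<Sum>e\<in>I. f (snd e) * g e)"
    by (rule sum.mono_neutral_right) (use E finI finJ in \<open>auto simp: I_def J_def A_def\<close>)
  also have "(\<Sum>e\<in>I \<union> J. f (fst e) * g e) = (\<Sum>e\<in>J. f (fst e) * g e)"
    by (rule sum.mono_neutral_right) (use E finI finJ in \<open>auto simp: I_def J_def A_def\<close>)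
  also have "(\<Sum>e\<in>I. f (snd e) * g e) =
      (\<Sum>(x, y)\<in>(SIGMA x:A. {y. (y, x) \<in> E}). f x * g (y, x))"
    unfolding I by (subst sum.reindex) (auto simp: inj_on_def case_prod_beta)
  also have "\<dots> = (\<Sum>x\<in>A. \<Sum>y | (y, x) \<in> E. f x * g (y, x))"
    by (rule sum.Sigma [symmetric]) (use A fin in auto)
  also have "(\<Sum>e\<in>J. f (fst e) * g e) = (\<Sum>(x, y)\<in>J. f x * g (x, y))"
    by (simp add: case_prod_beta)
  also have "\<dots> = (\<Sum>x\<in>A. \<Sum>y | (x, y) \<in> E. f x * g (x, y))"
    unfolding J by (rule sum.Sigma [symmetric]) (use A fin in auto)
  also have "(\<Sum>x\<in>A. \<Sum>y | (y, x) \<in> E. f x * g (y, x)) -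
      (\<Sum>x\<in>A. \<Sum>y | (x, y) \<in> E. f x * g (x, y)) = (\<Sum>x\<in>A. f x * gradient_adj E g x)"
    by (simp add: gradient_adj_def sum_subtractf sum_distrib_left right_diff_distrib)
  also have "\<dots> = (\<Sum>\<^sub>\<infinity>x\<in>A. f x * gradient_adj E g x)"
    using A by simp
  also have "\<dots> = (\<Sum>\<^sub>\<infinity>x\<in>V. f x * gradient_adj E g x)"
    by (rule infsum_cong_neutral) (auto simp: A_def)
  finally show ?thesis .
qed

lemma harmonic_iff_average:
  assumes "sym E" "\<And>x. finite {y. (x, y) \<in> E}" "\<And>x. x \<in> V \<Longrightarrow> {y. (x, y) \<in> E} \<noteq> {}"
  shows "harmonic V E f \<longleftrightarrow>
    (\<forall>x\<in>V. f x = (\<Sum>y | (x, y) \<in> E. f y) / real (card {y. (x, y) \<in> E}))"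
proof -
  have "gradient_adj E (gradient f) x = 0 \<longleftrightarrow>
      f x = (\<Sum>y | (x, y) \<in> E. f y) / real (card {y. (x, y) \<in> E})" if "x \<in> V" for x
  proof -
    have N: "{y. (y, x) \<in> E} = {y. (x, y) \<in> E}"
      using assms(1) by (auto dest: symD)
    have "card {y. (x, y) \<in> E} \<noteq> 0"
      using assms that by simp
    then show ?thesis
      by (auto simp: gradient_adj_def gradient_def N sum_subtractf field_simps)
  qed
  then show ?thesis
    by (simp add: harmonic_def)
qed

lemma (in group) sym_cayley_edges:
  assumes "S \<subseteq> carrier G"
  shows "sym (cayley_edges G S)"
proof (rule symI)
  fix x y assume "(x, y) \<in> cayley_edges G S"
  then have *: "x \<in> carrier G" "y \<in> carrier G" "inv x \<otimes> y \<in> S \<union> m_inv G ` S"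
    by (auto simp: cayley_edges_def symmetrized_def)
  have "inv y \<otimes> x = inv (inv x \<otimes> y)"
    using * by (simp add: inv_mult_group)
  moreover have "inv (inv x \<otimes> y) \<in> S \<union> m_inv G ` S"
    using *(3) assms by auto
  ultimately show "(y, x) \<in> cayley_edges G S"
    using * by (simp add: cayley_edges_def symmetrized_def)
qed

lemma (in group) finite_cayley_neighbours:
  assumes "finite S"
  shows "finite {y. (x, y) \<in> cayley_edges G S}"
proof (rule finite_subset)
  show "{y. (x, y) \<in> cayley_edges G S} \<subseteq> (\<lambda>s. x \<otimes> s) ` symmetrized G S"
  proof
    fix y assume "y \<in> {y. (x, y) \<in> cayley_edges G S}"
    then have *: "x \<in> carrier G" "y \<in> carrier G" "inv x \<otimes> y \<in> symmetrized G S"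
      by (auto simp: cayley_edges_def)
    then have "y = x \<otimes> (inv x \<otimes> y)"
      by (simp add: m_assoc [symmetric])
    with * show "y \<in> (\<lambda>s. x \<otimes> s) ` symmetrized G S"
      by blast
  qed
  show "finite ((\<lambda>s. x \<otimes> s) ` symmetrized G S)"
    using assms by (simp add: symmetrized_def)
qed

end

theory Submission
  imports Defs
begin

text \<open>
  The proof plays the entropy of the simple random walk \<open>X\<^sub>n\<close> on the Cayley graph, started at the
  identity, against the second moment of a harmonic function along the walk. It is an entropy
  argument in the style of Benjamini, Duminil-Copin, Kozma and Yadin and uses no structure theory
  of groups of polynomial growth.

  Left translations preserve the graph, so it is enough to treat a harmonic \<open>g\<close> that vanishes at
  the identity and to show \<open>g s = 0\<close> for every generator \<open>s\<close>. Three facts are combined.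

  \<^item> Entropy. Since \<open>X\<^sub>n\<close> lives in the ball of radius \<open>n\<close>, its entropy \<open>H\<^sub>n\<close> is at most
    \<open>ln C + d ln n\<close>. Hence \<open>H\<^sub>n\<^sub>+\<^sub>1 - H\<^sub>n \<le> (d + 1) / (n + 1)\<close> for infinitely many \<open>n\<close>
    (\<open>small_entropy_increments\<close>), because otherwise the entropy would outgrow \<open>d ln n\<close>.
    The increment is the mutual information between the first step and \<open>X\<^sub>n\<^sub>+\<^sub>1\<close>, and it bounds
    the squared Hellinger distances between the law of \<open>X\<^sub>n\<^sub>+\<^sub>1\<close> and the same law conditioned
    on the first step (\<open>entropy_increment\<close>).

  \<^item> Second moment. The process \<open>g (X\<^sub>n)\<close> is a martingale, so \<open>E g (X\<^sub>n)\<^sup>2\<close> is the sum over \<open>k < n\<close>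
    of the mean squared gradient seen at time \<open>k\<close>. On an infinite group the walk spends a
    vanishing proportion of its time at any given point (\<open>visits_sublinear\<close>, by the maximum
    principle), while the gradient is small off a finite set. So \<open>E g (X\<^sub>n)\<^sup>2 = o(n)\<close>
    (\<open>second_moment_sublinear\<close>). On a finite group \<open>g\<close> is bounded and this is trivial.

  \<^item> Comparison. The values \<open>g s\<close> and \<open>g \<one> = 0\<close> are the means of \<open>g (X\<^sub>n\<^sub>+\<^sub>1)\<close> with and without
    conditioning on the first step being \<open>s\<close>. By Cauchy-Schwarz, \<open>(g s)\<^sup>2\<close> is at most a constant
    times \<open>(H\<^sub>n\<^sub>+\<^sub>1 - H\<^sub>n) * E g (X\<^sub>n\<^sub>+\<^sub>1)\<^sup>2\<close> (\<open>increment_le_entropy_increment\<close>).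

  Along the good times \<open>n\<close> the last product is \<open>O(1/n) * o(n)\<close>, which tends to \<open>0\<close>.
\<close>

section \<open>Word balls\<close>

context group
begin

lemma symmetrized_subset: "R \<subseteq> carrier G \<Longrightarrow> symmetrized G R \<subseteq> carrier G"
  by (auto simp: symmetrized_def)

lemma inv_symmetrized:
  assumes "R \<subseteq> carrier G" "t \<in> symmetrized G R" shows "inv t \<in> symmetrized G R"
  using assms by (auto simp: symmetrized_def subset_iff image_iff)

lemma word_ball_subset: "R \<subseteq> carrier G \<Longrightarrow> word_ball G R n \<subseteq> carrier G"
  using symmetrized_subset[of R] by (induction n) (fastforce simp: set_mult_def)+

lemma finite_word_ball: "finite R \<Longrightarrow> finite (word_ball G R n)"
  by (induction n) (auto simp: set_mult_def symmetrized_def)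

lemma word_ball_mono: "m \<le> n \<Longrightarrow> word_ball G R m \<subseteq> word_ball G R n"
  by (induction n rule: dec_induct) auto

lemma word_ball_mult:
  assumes R: "R \<subseteq> carrier G" and x: "x \<in> word_ball G R m"
  shows "y \<in> word_ball G R n \<Longrightarrow> x \<otimes> y \<in> word_ball G R (m + n)"
proof (induction n arbitrary: y)
  case 0
  then show ?case using x word_ball_subset[OF R, of m] by (simp add: subset_iff)
next
  case (Suc n)
  show ?case
  proof (cases "y \<in> word_ball G R n")
    case True
    then show ?thesis using Suc.IH by simp
  next
    case False
    then obtain z t where z: "z \<in> word_ball G R n" and t: "t \<in> symmetrized G R"
      and y: "y = z \<otimes> t"
      using Suc.prems by (auto simp: set_mult_def)
    have "x \<otimes> y = (x \<otimes> z) \<otimes> t"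
      using x z t word_ball_subset[OF R] symmetrized_subset[OF R]
      unfolding y by (intro m_assoc[symmetric]) auto
    then show ?thesis
      using Suc.IH[OF z] t by (auto simp: set_mult_def)
  qed
qed

lemma symmetrized_subset_word_ball:
  assumes "R \<subseteq> carrier G" shows "symmetrized G R \<subseteq> word_ball G R 1"
  using symmetrized_subset[OF assms] by (force simp: set_mult_def)

lemma generate_in_word_ball:
  assumes R: "R \<subseteq> carrier G" and "x \<in> generate G R"
  shows "\<exists>n. x \<in> word_ball G R n"
  using assms(2)
proof induction
  case one
  have "\<one> \<in> word_ball G R 0" by simp
  then show ?case ..
next
  case (incl h)
  then show ?case
    using symmetrized_subset_word_ball[OF R] unfolding symmetrized_def by blast
next
  case (inv h)
  then show ?case
    using symmetrized_subset_word_ball[OF R] unfolding symmetrized_def by blast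
next
  case (eng h1 h2)
  then show ?case using word_ball_mult[OF R] by blast
qed

text \<open>Polynomial growth is a hypothesis about some generating set, whereas the walk uses a given one.
  Each generator in \<open>S\<close> has bounded length over the other set, so balls over \<open>S\<close> sit in
  balls whose radius is larger by a constant factor only.\<close>

lemma polynomial_growth_word_ball:
  assumes pg: "polynomial_growth G" and S: "finite_generating_set G S"
  shows "\<exists>(C::real) (d::nat). \<forall>n\<ge>1. real (card (word_ball G S n)) \<le> C * real n ^ d"
proof -
  obtain R C d where R: "finite_generating_set G R"
    and C: "\<And>n. n \<ge> 1 \<Longrightarrow> real (card (word_ball G R n)) \<le> C * real n ^ d"
    using pg by (auto simp: polynomial_growth_def)
  have Rc: "R \<subseteq> carrier G" and Rf: "finite R" and Rg: "generate G R = carrier G"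
    using R by (auto simp: finite_generating_set_def)
  have Sc: "S \<subseteq> carrier G" and Sf: "finite S"
    using S by (auto simp: finite_generating_set_def)
  let ?T = "symmetrized G S"
  have "\<forall>t\<in>?T. \<exists>n. t \<in> word_ball G R n"
    using generate_in_word_ball[OF Rc] Rg symmetrized_subset[OF Sc] by blast
  then obtain len where len: "\<And>t. t \<in> ?T \<Longrightarrow> t \<in> word_ball G R (len t)"
    by metis
  \<comment> \<open>The successor ensures that \<open>n * k\<close> is positive, which the growth bound requires.\<close>
  define k where "k = Suc (\<Sum>t\<in>?T. len t)"
  have T: "?T \<subseteq> word_ball G R k"
  proof
    fix t assume t: "t \<in> ?T"
    have "finite ?T" using Sf by (simp add: symmetrized_def)
    then have "len t \<le> k" unfolding k_def using t by (simp add: member_le_sum le_SucI)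
    then show "t \<in> word_ball G R k" using len[OF t] word_ball_mono by blast
  qed
  have sub: "word_ball G S n \<subseteq> word_ball G R (n * k)" for n
  proof (induction n)
    case (Suc n)
    have "word_ball G S n <#> ?T \<subseteq> word_ball G R (n * k + k)"
      using Suc T word_ball_mult[OF Rc] by (fastforce simp: set_mult_def)
    moreover have "word_ball G S n \<subseteq> word_ball G R (n * k + k)"
      using Suc word_ball_mono[of "n * k" "n * k + k" R] by auto
    ultimately show ?case by (simp add: add.commute)
  qed simp
  have "real (card (word_ball G S n)) \<le> (C * real k ^ d) * real n ^ d" if n: "n \<ge> 1" for n
  proof -
    have "card (word_ball G S n) \<le> card (word_ball G R (n * k))"
      by (rule card_mono[OF finite_word_ball[OF Rf] sub])
    moreover have "n * k \<ge> 1" using n by (simp add: k_def)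
    ultimately show ?thesis using C[of "n * k"] by (simp add: power_mult_distrib mult_ac)
  qed
  then show ?thesis by blast
qed

end

section \<open>The simple random walk\<close>

locale cayley_walk = group G for G (structure) +
  fixes S :: "'a set"
  assumes generating: "finite_generating_set G S" and nonempty: "S \<noteq> {}"
begin

abbreviation T where "T \<equiv> symmetrized G S"
abbreviation wball where "wball \<equiv> word_ball G S"

definition avg :: "('a \<Rightarrow> real) \<Rightarrow> real" where
  "avg h = (\<Sum>t\<in>T. h t) / real (card T)"

lemma S_carrier: "S \<subseteq> carrier G" and finite_S: "finite S" and generate_S: "generate G S = carrier G"
  using generating by (auto simp: finite_generating_set_def)

lemma T_carrier [simp]: "t \<in> T \<Longrightarrow> t \<in> carrier G"
  using symmetrized_subset[OF S_carrier] by auto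

lemma inv_T [simp]: "t \<in> T \<Longrightarrow> inv t \<in> T"
  by (rule inv_symmetrized[OF S_carrier])

lemma finite_T [simp]: "finite T"
  using finite_S by (simp add: symmetrized_def)

lemma T_nonempty: "T \<noteq> {}"
  using nonempty by (auto simp: symmetrized_def)

lemma card_T_pos [simp]: "0 < card T"
  using T_nonempty by (simp add: card_gt_0_iff)

lemma ball_carrier: "x \<in> wball n \<Longrightarrow> x \<in> carrier G"
  using word_ball_subset[OF S_carrier] by auto

lemma finite_ball [simp]: "finite (wball n)"
  by (rule finite_word_ball[OF finite_S])

lemma left_mult_ball: "t \<in> T \<Longrightarrow> x \<in> wball n \<Longrightarrow> t \<otimes> x \<in> wball (Suc n)"
  using word_ball_mult[OF S_carrier, of t 1 x n] symmetrized_subset_word_ball[OF S_carrier] by auto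

lemma avg_cong: "(\<And>t. t \<in> T \<Longrightarrow> g t = h t) \<Longrightarrow> avg g = avg h"
  by (simp add: avg_def)

lemma avg_add: "avg (\<lambda>t. g t + h t) = avg g + avg h"
  by (simp add: avg_def sum.distrib add_divide_distrib)

lemma avg_diff: "avg (\<lambda>t. g t - h t) = avg g - avg h"
  by (simp add: avg_def sum_subtractf diff_divide_distrib)

lemma avg_cmult: "avg (\<lambda>t. c * h t) = c * avg h"
  by (simp add: avg_def sum_distrib_left)

lemma avg_const: "avg (\<lambda>t. c) = c"
  using T_nonempty by (simp add: avg_def)

lemma avg_mono: "(\<And>t. t \<in> T \<Longrightarrow> g t \<le> h t) \<Longrightarrow> avg g \<le> avg h"
  by (simp add: avg_def divide_right_mono sum_mono)

lemma avg_sum: "avg (\<lambda>t. \<Sum>i\<in>I. h i t) = (\<Sum>i\<in>I. avg (h i))"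
  by (simp add: avg_def sum.swap[of _ I] sum_divide_distrib)

lemma le_card_avg:
  assumes "\<And>t. t \<in> T \<Longrightarrow> 0 \<le> h t" "t \<in> T"
  shows "h t \<le> real (card T) * avg h"
  using assms member_le_sum[of t T h] T_nonempty by (simp add: avg_def)

text \<open>\<open>mean n h\<close> is the expectation of \<open>h (X\<^sub>n)\<close>. The recursion conditions on the first step;
  conditioning on the last step gives the same value by \<open>mean_Suc_right\<close>. The first form governs
  the entropy, the second one the martingale property.\<close>

primrec mean :: "nat \<Rightarrow> ('a \<Rightarrow> real) \<Rightarrow> real" where
  "mean 0 h = h \<one>"
| "mean (Suc n) h = avg (\<lambda>t. mean n (\<lambda>y. h (t \<otimes> y)))"

definition law :: "nat \<Rightarrow> 'a \<Rightarrow> real" where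
  "law n x = mean n (\<lambda>y. of_bool (y = x))"

lemma mean_cong: "(\<And>y. y \<in> wball n \<Longrightarrow> g y = h y) \<Longrightarrow> mean n g = mean n h"
proof (induction n arbitrary: g h)
  case (Suc n)
  show ?case
    unfolding mean.simps by (intro avg_cong Suc.IH Suc.prems left_mult_ball)
qed simp

lemma mean_mono: "(\<And>y. y \<in> wball n \<Longrightarrow> g y \<le> h y) \<Longrightarrow> mean n g \<le> mean n h"
proof (induction n arbitrary: g h)
  case (Suc n)
  show ?case
    unfolding mean.simps by (intro avg_mono Suc.IH Suc.prems left_mult_ball)
qed simp

lemma mean_add: "mean n (\<lambda>y. g y + h y) = mean n g + mean n h"
  by (induction n arbitrary: g h) (simp_all add: avg_add)

lemma mean_cmult: "mean n (\<lambda>y. c * h y) = c * mean n h"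
  by (induction n arbitrary: h) (simp_all add: avg_cmult)

lemma mean_const: "mean n (\<lambda>y. c) = c"
  by (induction n) (simp_all add: avg_const)

lemma mean_sum: "mean n (\<lambda>y. \<Sum>i\<in>I. h i y) = (\<Sum>i\<in>I. mean n (h i))"
  by (induction n arbitrary: h) (simp_all add: avg_sum)

text \<open>Associativity is what lets the first and the last step of the walk be exchanged.\<close>

lemma mean_Suc_right: "mean (Suc n) h = mean n (\<lambda>y. avg (\<lambda>t. h (y \<otimes> t)))"
proof (induction n arbitrary: h)
  case 0
  show ?case by (auto intro!: avg_cong)
next
  case (Suc n)
  have "mean (Suc (Suc n)) h = avg (\<lambda>s. mean n (\<lambda>y. avg (\<lambda>t. h (s \<otimes> (y \<otimes> t)))))"
    by (subst mean.simps(2)) (simp only: Suc.IH)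
  also have "\<dots> = avg (\<lambda>s. mean n (\<lambda>y. avg (\<lambda>t. h (s \<otimes> y \<otimes> t))))"
    by (intro avg_cong mean_cong) (simp add: m_assoc ball_carrier)
  finally show ?case by simp
qed

lemma law_nonneg: "0 \<le> law n x"
  using mean_mono[of n "\<lambda>_. 0" "\<lambda>y. of_bool (y = x)"] by (simp add: law_def mean_const)

lemma law_outside: "x \<notin> wball n \<Longrightarrow> law n x = 0"
  using mean_cong[of n "\<lambda>y. of_bool (y = x)" "\<lambda>_. 0"] by (auto simp: law_def mean_const)

lemma law_Suc:
  assumes x: "x \<in> carrier G"
  shows "law (Suc n) x = avg (\<lambda>t. law n (inv t \<otimes> x))"
  unfolding law_def mean.simps(2)
proof (intro avg_cong mean_cong)
  fix t y assume "t \<in> T" "y \<in> wball n"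
  then have "t \<otimes> y = x \<longleftrightarrow> y = inv t \<otimes> x"
    using x T_carrier ball_carrier by (metis inv_solve_left)
  then show "of_bool (t \<otimes> y = x) = (of_bool (y = inv t \<otimes> x) :: real)" by simp
qed

lemma mean_eq_sum:
  assumes A: "finite A" "wball n \<subseteq> A"
  shows "mean n h = (\<Sum>x\<in>A. law n x * h x)"
proof -
  have "mean n h = mean n (\<lambda>y. \<Sum>x\<in>A. h x * of_bool (y = x))"
    using A by (intro mean_cong) (simp add: subset_iff)
  also have "\<dots> = (\<Sum>x\<in>A. h x * law n x)"
    by (simp add: mean_sum mean_cmult law_def)
  finally show ?thesis by (simp add: mult.commute)
qed

lemma sum_law: "finite A \<Longrightarrow> wball n \<subseteq> A \<Longrightarrow> (\<Sum>x\<in>A. law n x) = 1"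
  using mean_eq_sum[of A n "\<lambda>_. 1"] by (simp add: mean_const)

lemma sum_law_le:
  assumes "finite A" shows "(\<Sum>x\<in>A. law n x) \<le> 1"
proof -
  have "(\<Sum>x\<in>A. law n x) \<le> (\<Sum>x\<in>A \<union> wball n. law n x)"
    using assms by (intro sum_mono2) (auto simp: law_nonneg)
  also have "\<dots> = 1" using assms by (intro sum_law) auto
  finally show ?thesis .
qed

lemma law_le_1: "law n x \<le> 1"
  using sum_law_le[of "{x}" n] by simp

section \<open>Entropy\<close>

definition entropy :: "nat \<Rightarrow> real" where
  "entropy n = - mean n (\<lambda>x. ln (law n x))"

text \<open>The uniform distribution maximises the entropy on a finite set; the inequality
  \<open>ln u \<le> u - 1\<close> at \<open>u = 1 / (p N)\<close>, summed with weights \<open>p\<close>, shows it directly.\<close>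

lemma entropy_le_ln_card_ball: "entropy n \<le> ln (real (card (wball n)))"
proof -
  let ?N = "real (card (wball n))"
  have "\<one> \<in> wball n" using word_ball_mono[of 0 n S] by auto
  then have ne: "wball n \<noteq> {}" by blast
  then have N: "?N > 0" by (simp add: card_gt_0_iff)
  have "law n x * (- ln (law n x) - ln ?N) \<le> 1 / ?N - law n x" for x
  proof (cases "law n x = 0")
    case False
    then have p: "law n x > 0" using law_nonneg[of n x] by simp
    have "- ln (law n x) - ln ?N = ln (1 / (law n x * ?N))"
      using p ne by (simp add: ln_div ln_mult)
    also have "\<dots> \<le> 1 / (law n x * ?N) - 1"
      using p N by (intro ln_le_minus_one) simp
    finally have "law n x * (- ln (law n x) - ln ?N) \<le> law n x * (1 / (law n x * ?N) - 1)"
      using p by (intro mult_left_mono) simp_all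
    also have "\<dots> = 1 / ?N - law n x" using p ne by (simp add: field_simps)
    finally show ?thesis .
  qed simp
  then have "(\<Sum>x\<in>wball n. law n x * (- ln (law n x) - ln ?N)) \<le> (\<Sum>x\<in>wball n. 1 / ?N - law n x)"
    by (intro sum_mono)
  also have "\<dots> = 0" using ne by (simp add: sum_subtractf sum_law)
  also have "(\<Sum>x\<in>wball n. law n x * (- ln (law n x) - ln ?N))
      = - (\<Sum>x\<in>wball n. law n x * ln (law n x)) - (\<Sum>x\<in>wball n. law n x) * ln ?N"
    by (simp add: right_diff_distrib sum_subtractf sum_negf sum_distrib_right)
  also have "(\<Sum>x\<in>wball n. law n x * ln (law n x)) = mean n (\<lambda>x. ln (law n x))"
    by (rule mean_eq_sum[symmetric]) auto
  finally show ?thesis by (simp add: entropy_def sum_law)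
qed

text \<open>The pointwise form of the bound of squared Hellinger distance by relative entropy. The terms
  \<open>- a + m\<close> make it hold pointwise and cancel once two probability distributions are compared.
  Divided by \<open>2 a\<close>, it is \<open>ln u \<le> u - 1\<close> at \<open>u = sqrt m / sqrt a\<close>.\<close>

lemma hellinger_le_relative_entropy:
  fixes a m :: real
  assumes "a \<ge> 0" "m > 0"
  shows "(sqrt a - sqrt m)\<^sup>2 \<le> a * ln a - a * ln m - a + m"
proof (cases "a = 0")
  case False
  then have a: "a > 0" using assms by simp
  have "ln (sqrt m / sqrt a) \<le> sqrt m / sqrt a - 1"
    using a assms by (intro ln_le_minus_one) simp
  then have "ln m / 2 - ln a / 2 \<le> sqrt m / sqrt a - 1"
    using a assms by (simp add: ln_div ln_sqrt)
  then have "2 * a * (ln m / 2 - ln a / 2) \<le> 2 * a * (sqrt m / sqrt a - 1)"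
    using a by (intro mult_left_mono) simp_all
  also have "\<dots> = 2 * (sqrt a * sqrt m) - 2 * a"
  proof -
    have "a * (sqrt m / sqrt a) = a / sqrt a * sqrt m" by simp
    also have "\<dots> = sqrt a * sqrt m" using a by (simp only: real_div_sqrt[OF less_imp_le])
    finally show ?thesis by (simp add: right_diff_distrib)
  qed
  finally show ?thesis
    using a assms by (simp add: power2_diff field_simps)
qed (use assms in simp)

text \<open>The translated law \<open>\<lambda>x. law n (inv t \<otimes> x)\<close> is the law of \<open>X\<^sub>n\<^sub>+\<^sub>1\<close> given that the first
  step is \<open>t\<close>. Its support lies in the ball of radius \<open>n + 1\<close>, and \<open>F 0 x = 0\<close> makes the
  remaining points of that ball harmless.\<close>

lemma sum_law_translate:
  assumes t: "t \<in> T" and F: "\<And>x. F 0 x = (0::real)"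
  shows "(\<Sum>x\<in>wball (Suc n). F (law n (inv t \<otimes> x)) x) = (\<Sum>y\<in>wball n. F (law n y) (t \<otimes> y))"
proof -
  have tc: "t \<in> carrier G" using t by simp
  have "(\<Sum>x\<in>wball (Suc n). F (law n (inv t \<otimes> x)) x)
      = (\<Sum>x\<in>(\<lambda>y. t \<otimes> y) ` wball n. F (law n (inv t \<otimes> x)) x)"
  proof (rule sum.mono_neutral_right)
    show "(\<lambda>y. t \<otimes> y) ` wball n \<subseteq> wball (Suc n)" using left_mult_ball[OF t] by blast
    show "\<forall>x\<in>wball (Suc n) - (\<lambda>y. t \<otimes> y) ` wball n. F (law n (inv t \<otimes> x)) x = 0"
    proof
      fix x assume x: "x \<in> wball (Suc n) - (\<lambda>y. t \<otimes> y) ` wball n"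
      then have "x \<in> carrier G" using ball_carrier by blast
      then have "x = t \<otimes> (inv t \<otimes> x)" using tc by (simp add: m_assoc[symmetric])
      then have "inv t \<otimes> x \<notin> wball n" using x by blast
      then show "F (law n (inv t \<otimes> x)) x = 0" by (simp add: law_outside F)
    qed
  qed (rule finite_ball)
  also have "\<dots> = (\<Sum>y\<in>wball n. F (law n (inv t \<otimes> (t \<otimes> y))) (t \<otimes> y))"
    by (rule sum.reindex[unfolded comp_def])
       (use tc ball_carrier in \<open>auto simp: inj_on_def\<close>)
  also have "\<dots> = (\<Sum>y\<in>wball n. F (law n y) (t \<otimes> y))"
    using tc ball_carrier by (intro sum.cong) (simp_all add: m_assoc[symmetric])
  finally show ?thesis .
qed

lemma law_translate_le:
  assumes "t \<in> T" "x \<in> carrier G"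
  shows "law n (inv t \<otimes> x) \<le> real (card T) * law (Suc n) x"
  unfolding law_Suc[OF assms(2)]
  using assms by (intro le_card_avg) (simp_all add: law_nonneg)

text \<open>By \<open>law_Suc\<close>, the law of \<open>X\<^sub>n\<^sub>+\<^sub>1\<close> is the average of its conditional laws given the first step,
  and each of these is a translate of the law of \<open>X\<^sub>n\<close>, so has entropy \<open>entropy n\<close>. Hence the
  increment is the average relative entropy of the conditional laws with respect to their average.\<close>

lemma entropy_increment:
  "avg (\<lambda>t. \<Sum>x\<in>wball (Suc n). (sqrt (law n (inv t \<otimes> x)) - sqrt (law (Suc n) x))\<^sup>2)
    \<le> entropy (Suc n) - entropy n"
proof -
  let ?A = "wball (Suc n)"
  let ?a = "\<lambda>t x. law n (inv t \<otimes> x)" and ?m = "law (Suc n)"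
  have pointwise: "avg (\<lambda>t. (sqrt (?a t x) - sqrt (?m x))\<^sup>2)
      \<le> avg (\<lambda>t. ?a t x * ln (?a t x)) - ?m x * ln (?m x)" if "x \<in> ?A" for x
  proof -
    have x: "x \<in> carrier G" using that ball_carrier by blast
    show ?thesis
    proof (cases "?m x = 0")
      case True
      have "?a t x = 0" if "t \<in> T" for t
        using law_translate_le[OF that x, of n] True law_nonneg[of n "inv t \<otimes> x"] by simp
      then show ?thesis using True by (simp add: avg_def)
    next
      case False
      then have m: "?m x > 0" using law_nonneg[of "Suc n" x] by simp
      have "avg (\<lambda>t. (sqrt (?a t x) - sqrt (?m x))\<^sup>2)
          \<le> avg (\<lambda>t. ?a t x * ln (?a t x) - ln (?m x) * ?a t x - ?a t x + ?m x)"
        using hellinger_le_relative_entropy[OF law_nonneg m, of n]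
        by (intro avg_mono) (simp only: mult.commute[of "ln (?m x)"])
      also have "\<dots> = avg (\<lambda>t. ?a t x * ln (?a t x)) - ln (?m x) * ?m x - ?m x + ?m x"
        by (simp only: avg_add avg_diff avg_cmult avg_const law_Suc[OF x])
      finally show ?thesis by (simp add: mult.commute)
    qed
  qed
  have "avg (\<lambda>t. \<Sum>x\<in>?A. (sqrt (?a t x) - sqrt (?m x))\<^sup>2)
      = (\<Sum>x\<in>?A. avg (\<lambda>t. (sqrt (?a t x) - sqrt (?m x))\<^sup>2))"
    by (rule avg_sum)
  also have "\<dots> \<le> (\<Sum>x\<in>?A. avg (\<lambda>t. ?a t x * ln (?a t x)) - ?m x * ln (?m x))"
    by (intro sum_mono pointwise)
  also have "\<dots> = avg (\<lambda>t. \<Sum>x\<in>?A. ?a t x * ln (?a t x)) - (\<Sum>x\<in>?A. ?m x * ln (?m x))"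
    by (simp only: sum_subtractf avg_sum)
  also have "avg (\<lambda>t. \<Sum>x\<in>?A. ?a t x * ln (?a t x)) = avg (\<lambda>t. - entropy n)"
  proof (rule avg_cong)
    fix t assume "t \<in> T"
    then have "(\<Sum>x\<in>?A. ?a t x * ln (?a t x)) = (\<Sum>y\<in>wball n. law n y * ln (law n y))"
      by (rule sum_law_translate[where F = "\<lambda>p _. p * ln p"]) simp
    also have "\<dots> = - entropy n"
      unfolding entropy_def by (simp add: mean_eq_sum[OF finite_ball order_refl])
    finally show "(\<Sum>x\<in>?A. ?a t x * ln (?a t x)) = - entropy n" .
  qed
  also have "(\<Sum>x\<in>?A. ?m x * ln (?m x)) = - entropy (Suc n)"
    unfolding entropy_def minus_minus by (rule mean_eq_sum[OF finite_ball order_refl, symmetric])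
  finally show ?thesis by (simp add: avg_const)
qed

text \<open>The harmonic series diverges like \<open>ln n\<close>: increments that exceed \<open>(d + 1) / (n + 1)\<close> from
  some point on would push the entropy above \<open>d ln n + O(1)\<close>.\<close>

lemma small_entropy_increments:
  assumes growth: "\<And>n. n \<ge> 1 \<Longrightarrow> real (card (wball n)) \<le> C * real n ^ d"
  shows "\<exists>n\<ge>N. entropy (Suc n) - entropy n \<le> real (Suc d) / real (Suc n)"
proof (rule ccontr)
  assume "\<not> ?thesis"
  then have big: "entropy (Suc n) - entropy n > real (Suc d) / real (Suc n)" if "n \<ge> N" for n
    using that by force
  have card_pos: "0 < card (wball n)" for n
    using word_ball_mono[of 0 n S] by (auto simp: card_gt_0_iff)
  have C: "C > 0" using growth[of 1] card_pos[of 1] by (simp del: word_ball.simps)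
  have lower: "entropy N + real (Suc d) * (ln (real (Suc n)) - ln (real (Suc N))) \<le> entropy n"
    if "n \<ge> N" for n
    using that
  proof (induction n rule: dec_induct)
    case (step n)
    have "ln (real (Suc (Suc n))) - ln (real (Suc n)) = ln (real (Suc (Suc n)) / real (Suc n))"
      by (simp add: ln_div del: of_nat_Suc)
    also have "\<dots> \<le> real (Suc (Suc n)) / real (Suc n) - 1"
      by (intro ln_le_minus_one) simp
    also have "\<dots> = 1 / real (Suc n)" by (simp add: field_simps)
    finally have "real (Suc d) * (ln (real (Suc (Suc n))) - ln (real (Suc n)))
        \<le> real (Suc d) * (1 / real (Suc n))"
      by (intro mult_left_mono) simp_all
    then show ?case using step.IH big[OF step.hyps(1)] by (simp add: right_diff_distrib)
  qed simp
  have upper: "entropy n \<le> ln C + real d * ln (real (Suc n))" if "n \<ge> 1" for n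
  proof -
    have "entropy n \<le> ln (real (card (wball n)))" by (rule entropy_le_ln_card_ball)
    also have "\<dots> \<le> ln (C * real n ^ d)"
      using growth[OF that] card_pos[of n] by (intro ln_mono) simp_all
    also have "\<dots> = ln C + real d * ln (real n)"
      using C that by (simp add: ln_mult ln_realpow)
    also have "\<dots> \<le> ln C + real d * ln (real (Suc n))"
      using that by (intro add_left_mono mult_left_mono) simp_all
    finally show ?thesis .
  qed
  define c where "c = ln C - entropy N + real (Suc d) * ln (real (Suc N))"
  have bound: "ln (real (Suc n)) \<le> c" if "n \<ge> max N 1" for n
    using lower[of n] upper[of n] that by (simp add: c_def algebra_simps)
  obtain n where n: "real n > exp c" using reals_Archimedean2 by blast
  define k where "k = max n (max N 1)"
  have "exp c < real (Suc k)" using n by (simp add: k_def)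
  then have "c < ln (real (Suc k))" by (metis exp_less_cancel_iff exp_ln of_nat_0_less_iff zero_less_Suc)
  then show False using bound[of k] by (simp add: k_def)
qed

section \<open>Occupation times\<close>

definition visits :: "nat \<Rightarrow> 'a \<Rightarrow> real" where
  "visits n x = (\<Sum>k<n. law k x)"

lemma visits_nonneg: "0 \<le> visits n x"
  by (simp add: visits_def law_nonneg sum_nonneg)

text \<open>Averaging over the neighbours amounts to shifting time by one step, which changes the number of
  visits by at most one. So \<open>visits n\<close> is harmonic up to an error that does not depend on \<open>n\<close>.\<close>

lemma visits_le_avg:
  assumes "x \<in> carrier G"
  shows "visits n x - 1 \<le> avg (\<lambda>t. visits n (inv t \<otimes> x))"
proof -
  have "avg (\<lambda>t. visits n (inv t \<otimes> x)) = (\<Sum>k<n. law (Suc k) x)"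
    unfolding visits_def by (simp only: avg_sum law_Suc[OF assms])
  also have "\<dots> = visits n x + law n x - law 0 x"
    unfolding visits_def by (induction n) simp_all
  finally show ?thesis
    using law_nonneg[of n x] law_le_1[of 0 x] by linarith
qed

text \<open>A quantitative maximum principle: at a point where \<open>visits n\<close> is within \<open>b\<close> of its maximum, the
  average over the neighbours is within \<open>b + 1\<close> of it, and therefore so is, up to the factor
  \<open>card T\<close>, each single neighbour. Iterating along a word for \<open>w\<close> reaches \<open>w \<otimes> y\<close>. The loss \<open>c\<close>
  depends on \<open>w\<close> and \<open>b\<close>, but not on \<open>n\<close>, which is essential for letting \<open>n\<close> grow.\<close>

lemma visits_near_max:
  assumes "w \<in> carrier G"
  shows "\<exists>c. \<forall>n M y. y \<in> carrier G \<longrightarrow> (\<forall>x\<in>carrier G. visits n x \<le> M) \<longrightarrow> M - b \<le> visits n y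
    \<longrightarrow> M - c \<le> visits n (w \<otimes> y)"
proof -
  have neighbour: "\<exists>c. \<forall>n M y. y \<in> carrier G \<longrightarrow> (\<forall>x\<in>carrier G. visits n x \<le> M) \<longrightarrow> M - b \<le> visits n y
    \<longrightarrow> M - c \<le> visits n (w \<otimes> y)" if w: "w \<in> T" for w b
  proof (intro exI allI impI)
    fix n M y
    assume y: "y \<in> carrier G" and M: "\<forall>x\<in>carrier G. visits n x \<le> M" and b: "M - b \<le> visits n y"
    have "M - visits n (inv (inv w) \<otimes> y) \<le> real (card T) * avg (\<lambda>t. M - visits n (inv t \<otimes> y))"
      using M y w by (intro le_card_avg) simp_all
    also have "\<dots> \<le> real (card T) * (b + 1)"
      using visits_le_avg[OF y, of n] b
      by (intro mult_left_mono) (simp_all add: avg_diff avg_const)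
    finally show "M - real (card T) * (b + 1) \<le> visits n (w \<otimes> y)" using w by simp
  qed
  have "w \<in> generate G S" using assms generate_S by simp
  then show ?thesis
  proof (induction arbitrary: b)
    case one
    then show ?case by (intro exI[of _ b]) simp
  next
    case (incl h)
    then show ?case by (intro neighbour) (simp add: symmetrized_def)
  next
    case (inv h)
    then show ?case by (intro neighbour) (simp add: symmetrized_def)
  next
    case (eng h1 h2)
    have h: "h1 \<in> carrier G" "h2 \<in> carrier G" using eng.hyps generate_S by auto
    obtain c2 where c2: "\<And>n M y. y \<in> carrier G \<Longrightarrow> \<forall>x\<in>carrier G. visits n x \<le> M
        \<Longrightarrow> M - b \<le> visits n y \<Longrightarrow> M - c2 \<le> visits n (h2 \<otimes> y)"
      using eng.IH(2)[of b] by blast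
    obtain c1 where c1: "\<And>n M y. y \<in> carrier G \<Longrightarrow> \<forall>x\<in>carrier G. visits n x \<le> M
        \<Longrightarrow> M - c2 \<le> visits n y \<Longrightarrow> M - c1 \<le> visits n (h1 \<otimes> y)"
      using eng.IH(1)[of c2] by blast
    show ?case
      using c1 c2 h by (intro exI[of _ c1]) (simp add: m_assoc)
  qed
qed

lemma visits_attains_max:
  "\<exists>y\<in>carrier G. \<forall>x\<in>carrier G. visits n x \<le> visits n y"
proof -
  have "\<one> \<in> wball n" using word_ball_mono[of 0 n S] by auto
  then have ne: "visits n ` wball n \<noteq> {}" by blast
  obtain y where y: "y \<in> wball n" "visits n y = Max (visits n ` wball n)"
    using Max_in[OF _ ne] by auto
  have "visits n x \<le> visits n y" for x
  proof (cases "x \<in> wball n")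
    case True
    then show ?thesis unfolding y(2) by simp
  next
    case False
    then have "law k x = 0" if "k < n" for k
      using that word_ball_mono[of k n S] by (intro law_outside) auto
    then have "visits n x = 0" by (simp add: visits_def)
    then show ?thesis using visits_nonneg by simp
  qed
  then show ?thesis using y(1) ball_carrier by blast
qed

text \<open>If \<open>visits n\<close> has maximum \<open>M\<close> at \<open>y\<close>, then it is at least \<open>M - O(1)\<close> at the \<open>K\<close> points
  \<open>w \<otimes> y\<close> with \<open>w\<close> in a fixed set of \<open>K\<close> elements. All visits together number \<open>n\<close>, so
  \<open>M \<le> n / K + O(1)\<close>, where \<open>K\<close> is arbitrary in an infinite group.\<close>

lemma visits_sublinear:
  assumes inf: "infinite (carrier G)" and e: "\<epsilon> > 0"
  shows "\<exists>N. \<forall>n\<ge>N. \<forall>z\<in>carrier G. visits n z \<le> \<epsilon> * real n"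
proof -
  obtain K :: nat where K: "2 / \<epsilon> < real K" using reals_Archimedean2 by blast
  then have K0: "K > 0" using e by (cases K) (auto simp: divide_less_0_iff)
  obtain W where W: "finite W" "card W = K" "W \<subseteq> carrier G"
    using inf infinite_arbitrarily_large by blast
  have "\<forall>w\<in>W. \<exists>c. \<forall>n M y. y \<in> carrier G \<longrightarrow> (\<forall>x\<in>carrier G. visits n x \<le> M)
      \<longrightarrow> M - 0 \<le> visits n y \<longrightarrow> M - c \<le> visits n (w \<otimes> y)"
    using visits_near_max W(3) by blast
  then obtain c where c: "\<And>w n M y. w \<in> W \<Longrightarrow> y \<in> carrier G \<Longrightarrow> \<forall>x\<in>carrier G. visits n x \<le> M
      \<Longrightarrow> M - 0 \<le> visits n y \<Longrightarrow> M - c w \<le> visits n (w \<otimes> y)"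
    by metis
  define D where "D = (\<Sum>w\<in>W. c w) / K"
  have bound: "visits n z \<le> n / K + D" if z: "z \<in> carrier G" for n z
  proof -
    obtain y where y: "y \<in> carrier G" and max: "\<forall>x\<in>carrier G. visits n x \<le> visits n y"
      using visits_attains_max by blast
    have inj: "inj_on (\<lambda>w. w \<otimes> y) W" using inj_on_multc[OF y] W(3) by (rule inj_on_subset)
    have "K * visits n y - (\<Sum>w\<in>W. c w) = (\<Sum>w\<in>W. visits n y - c w)"
      using W by (simp add: sum_subtractf)
    also have "\<dots> \<le> (\<Sum>w\<in>W. visits n (w \<otimes> y))"
      using c[OF _ y max] by (intro sum_mono) simp
    also have "\<dots> = (\<Sum>x\<in>(\<lambda>w. w \<otimes> y) ` W. visits n x)"
      by (simp add: sum.reindex[OF inj])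
    also have "\<dots> = (\<Sum>k<n. \<Sum>x\<in>(\<lambda>w. w \<otimes> y) ` W. law k x)"
      unfolding visits_def by (rule sum.swap)
    also have "\<dots> \<le> (\<Sum>k<n. 1)"
      using W(1) by (intro sum_mono sum_law_le) simp
    finally have "K * visits n y \<le> n + (\<Sum>w\<in>W. c w)" by simp
    then have "visits n y \<le> n / K + D" using K0 by (simp add: D_def field_simps)
    then show ?thesis using max z by force
  qed
  obtain N :: nat where N: "2 * D / \<epsilon> < real N" using reals_Archimedean2 by blast
  have "visits n z \<le> \<epsilon> * real n" if "n \<ge> N" "z \<in> carrier G" for n z
  proof -
    have "1 / real K \<le> \<epsilon> / 2" using K K0 e by (simp add: field_simps)
    then have "real n / real K \<le> real n * (\<epsilon> / 2)"
      using mult_left_mono[of "1 / real K" "\<epsilon> / 2" "real n"] by simp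
    moreover have "2 * D / \<epsilon> < real n" using N that(1) by simp
    then have "D \<le> real n * (\<epsilon> / 2)" using e by (simp add: field_simps)
    moreover have "\<epsilon> * real n = real n * (\<epsilon> / 2) + real n * (\<epsilon> / 2)" by simp
    ultimately show ?thesis using bound[OF that(2), of n] by linarith
  qed
  then show ?thesis by blast
qed

section \<open>Harmonic functions along the walk\<close>

definition walk_harmonic :: "('a \<Rightarrow> real) \<Rightarrow> bool" where
  "walk_harmonic g \<longleftrightarrow> (\<forall>x\<in>carrier G. avg (\<lambda>t. g (x \<otimes> t)) = g x)"

definition energy :: "('a \<Rightarrow> real) \<Rightarrow> 'a \<Rightarrow> real" where
  "energy g x = avg (\<lambda>t. (g (x \<otimes> t) - g x)\<^sup>2)"

lemma walk_harmonic_translate: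
  assumes "walk_harmonic g" "z \<in> carrier G"
  shows "walk_harmonic (\<lambda>x. g (z \<otimes> x) - c)"
  unfolding walk_harmonic_def
proof
  fix x assume x: "x \<in> carrier G"
  have "avg (\<lambda>t. g (z \<otimes> (x \<otimes> t)) - c) = avg (\<lambda>t. g (z \<otimes> x \<otimes> t)) - c"
    using assms(2) x by (simp add: avg_diff avg_const m_assoc cong: avg_cong)
  then show "avg (\<lambda>t. g (z \<otimes> (x \<otimes> t)) - c) = g (z \<otimes> x) - c"
    using assms x by (simp add: walk_harmonic_def)
qed

lemma mean_walk_harmonic:
  assumes "walk_harmonic g" shows "mean n g = g \<one>"
proof (induction n)
  case (Suc n)
  have "mean (Suc n) g = mean n g"
    unfolding mean_Suc_right
    using assms ball_carrier by (intro mean_cong) (simp add: walk_harmonic_def)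
  then show ?case using Suc by simp
qed simp

text \<open>Orthogonality of martingale increments: given \<open>X\<^sub>n = x\<close>, the cross term
  \<open>2 g x (g (X\<^sub>n\<^sub>+\<^sub>1) - g x)\<close> has mean \<open>0\<close>.\<close>

lemma second_moment:
  assumes g: "walk_harmonic g" and g1: "g \<one> = 0"
  shows "mean n (\<lambda>x. (g x)\<^sup>2) = (\<Sum>k<n. mean k (energy g))"
proof (induction n)
  case 0
  show ?case using g1 by simp
next
  case (Suc n)
  have "avg (\<lambda>t. (g (x \<otimes> t))\<^sup>2) = (g x)\<^sup>2 + energy g x" if x: "x \<in> wball n" for x
  proof -
    have "(g (x \<otimes> t))\<^sup>2 = (g (x \<otimes> t) - g x)\<^sup>2 + 2 * g x * g (x \<otimes> t) - (g x)\<^sup>2" for t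
      by (simp add: power2_eq_square algebra_simps)
    then have "avg (\<lambda>t. (g (x \<otimes> t))\<^sup>2)
        = energy g x + 2 * g x * avg (\<lambda>t. g (x \<otimes> t)) - (g x)\<^sup>2"
      unfolding energy_def by (simp only: avg_add avg_diff avg_cmult avg_const)
    also have "avg (\<lambda>t. g (x \<otimes> t)) = g x"
      using g ball_carrier[OF x] by (simp add: walk_harmonic_def)
    finally show ?thesis by (simp add: power2_eq_square)
  qed
  then have "mean (Suc n) (\<lambda>x. (g x)\<^sup>2) = mean n (\<lambda>x. (g x)\<^sup>2 + energy g x)"
    unfolding mean_Suc_right by (intro mean_cong)
  then show ?case using Suc by (simp add: mean_add)
qed

lemma energy_nonneg: "0 \<le> energy g x"
  by (simp add: energy_def avg_def sum_nonneg)

text \<open>Off a finite set \<open>F\<close> the energy is at most \<open>\<epsilon> / 2\<close>, and the visits to \<open>F\<close> contribute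
  the sum of \<open>energy g z * visits n z\<close> over \<open>z \<in> F\<close>, which is sublinear by \<open>visits_sublinear\<close>.\<close>

lemma second_moment_sublinear:
  assumes g: "walk_harmonic g" and g1: "g \<one> = 0"
    and vanish: "\<And>\<delta>. \<delta> > 0 \<Longrightarrow> finite {x \<in> carrier G. energy g x > \<delta>}"
    and e: "\<epsilon> > 0"
  shows "\<exists>N. \<forall>n\<ge>N. mean n (\<lambda>x. (g x)\<^sup>2) \<le> \<epsilon> * real n"
proof (cases "finite (carrier G)")
  case True
  define Q where "Q = (\<Sum>x\<in>carrier G. (g x)\<^sup>2)"
  obtain N :: nat where N: "Q / \<epsilon> < real N" using reals_Archimedean2 by blast
  have "mean n (\<lambda>x. (g x)\<^sup>2) \<le> \<epsilon> * real n" if "n \<ge> N" for n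
  proof -
    have "mean n (\<lambda>x. (g x)\<^sup>2) \<le> mean n (\<lambda>_. Q)"
      unfolding Q_def using True ball_carrier
      by (intro mean_mono member_le_sum) simp_all
    moreover have "Q / \<epsilon> < real n" using N that by simp
    ultimately show ?thesis using e by (simp add: mean_const field_simps)
  qed
  then show ?thesis by blast
next
  case False
  define F where "F = {x \<in> carrier G. energy g x > \<epsilon> / 2}"
  have F: "finite F" unfolding F_def using e by (intro vanish) simp
  define Q where "Q = (\<Sum>z\<in>F. energy g z)"
  have Q: "Q \<ge> 0" unfolding Q_def by (simp add: sum_nonneg energy_nonneg)
  \<comment> \<open>Adding \<open>1\<close> to \<open>Q\<close> avoids a zero denominator when \<open>F\<close> carries no energy.\<close>
  have "\<epsilon> / (2 * (Q + 1)) > 0" using Q e by simp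
  from visits_sublinear[OF False this] obtain N
    where N: "\<And>n z. n \<ge> N \<Longrightarrow> z \<in> carrier G \<Longrightarrow> visits n z \<le> \<epsilon> / (2 * (Q + 1)) * real n"
    by blast
  have mean_energy: "mean k (energy g) \<le> \<epsilon> / 2 + (\<Sum>z\<in>F. energy g z * law k z)" for k
  proof -
    have "mean k (energy g) \<le> mean k (\<lambda>x. \<epsilon> / 2 + (\<Sum>z\<in>F. energy g z * of_bool (x = z)))"
    proof (rule mean_mono)
      fix x assume "x \<in> wball k"
      then have x: "x \<in> carrier G" by (rule ball_carrier)
      show "energy g x \<le> \<epsilon> / 2 + (\<Sum>z\<in>F. energy g z * of_bool (x = z))"
        using F x e by (cases "x \<in> F") (auto simp: F_def)
    qed
    then show ?thesis by (simp add: mean_add mean_const mean_sum mean_cmult law_def)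
  qed
  have "mean n (\<lambda>x. (g x)\<^sup>2) \<le> \<epsilon> * real n" if n: "n \<ge> N" for n
  proof -
    have "mean n (\<lambda>x. (g x)\<^sup>2) \<le> (\<Sum>k<n. \<epsilon> / 2 + (\<Sum>z\<in>F. energy g z * law k z))"
      unfolding second_moment[OF g g1] by (intro sum_mono mean_energy)
    also have "\<dots> = \<epsilon> / 2 * real n + (\<Sum>z\<in>F. energy g z * visits n z)"
      by (simp add: sum.distrib sum.swap[of _ F] visits_def sum_distrib_left)
    also have "(\<Sum>z\<in>F. energy g z * visits n z)
        \<le> (\<Sum>z\<in>F. energy g z * (\<epsilon> / (2 * (Q + 1)) * real n))"
      using N[OF n] by (intro sum_mono mult_left_mono) (auto simp: F_def energy_nonneg)
    also have "\<dots> = Q / (Q + 1) * (\<epsilon> / 2 * real n)"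
      unfolding Q_def[symmetric] sum_distrib_right[symmetric] by simp
    also have "\<dots> \<le> 1 * (\<epsilon> / 2 * real n)"
      using Q e by (intro mult_right_mono) simp_all
    finally show ?thesis by simp
  qed
  then show ?thesis by blast
qed

text \<open>With \<open>a\<close> the law of \<open>X\<^sub>n\<^sub>+\<^sub>1\<close> given the first step \<open>s\<close> and \<open>m\<close> its unconditional law,
  \<open>g s = g s - g \<one>\<close> is the sum of \<open>(a x - m x) * g x\<close>. Writing
  \<open>a - m = (sqrt a - sqrt m) * (sqrt a + sqrt m)\<close> and applying Cauchy-Schwarz separates the
  Hellinger distance from a second moment; the latter is controlled by the unconditional one
  since \<open>a \<le> card T * m\<close>.\<close>

lemma increment_le_entropy_increment:
  assumes g: "walk_harmonic g" and g1: "g \<one> = 0" and s: "s \<in> T"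
  shows "(g s)\<^sup>2 \<le> (real (card T) * (entropy (Suc n) - entropy n))
    * (2 * (real (card T) + 1) * mean (Suc n) (\<lambda>x. (g x)\<^sup>2))"
proof -
  let ?A = "wball (Suc n)"
  let ?a = "\<lambda>x. law n (inv s \<otimes> x)" and ?m = "law (Suc n)"
  have "g s = mean n (\<lambda>y. g (s \<otimes> y) - 0)"
    using s mean_walk_harmonic[OF walk_harmonic_translate[OF g, of s 0]] by simp
  also have "\<dots> = (\<Sum>y\<in>wball n. law n y * g (s \<otimes> y))"
    by (simp add: mean_eq_sum[OF finite_ball order_refl])
  also have "\<dots> = (\<Sum>x\<in>?A. ?a x * g x)"
    by (rule sum_law_translate[OF s, where F = "\<lambda>p x. p * g x", symmetric]) simp
  finally have gs: "g s = (\<Sum>x\<in>?A. ?a x * g x)" .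
  have "(\<Sum>x\<in>?A. ?m x * g x) = 0"
    using mean_walk_harmonic[OF g, of "Suc n"] g1
    by (simp only: mean_eq_sum[OF finite_ball order_refl])
  then have "g s = (\<Sum>x\<in>?A. ?a x * g x - ?m x * g x)"
    unfolding sum_subtractf using gs by simp
  also have "\<dots> = (\<Sum>x\<in>?A. (sqrt (?a x) - sqrt (?m x)) * ((sqrt (?a x) + sqrt (?m x)) * g x))"
  proof (intro sum.cong refl)
    fix x
    have "?a x - ?m x = (sqrt (?a x) - sqrt (?m x)) * (sqrt (?a x) + sqrt (?m x))"
      using square_diff_square_factored[of "sqrt (?a x)" "sqrt (?m x)"]
      by (simp add: law_nonneg mult.commute)
    then show "?a x * g x - ?m x * g x
        = (sqrt (?a x) - sqrt (?m x)) * ((sqrt (?a x) + sqrt (?m x)) * g x)"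
      by (simp only: left_diff_distrib[symmetric] mult.assoc[symmetric])
  qed
  finally have gs_eq: "g s = (\<Sum>x\<in>?A. (sqrt (?a x) - sqrt (?m x)) * ((sqrt (?a x) + sqrt (?m x)) * g x))" .
  have "(g s)\<^sup>2 \<le> (\<Sum>x\<in>?A. (sqrt (?a x) - sqrt (?m x))\<^sup>2)
      * (\<Sum>x\<in>?A. ((sqrt (?a x) + sqrt (?m x)) * g x)\<^sup>2)"
    unfolding gs_eq by (rule Cauchy_Schwarz_ineq_sum)
  also have "\<dots> \<le> (real (card T) * (entropy (Suc n) - entropy n))
    * (2 * (real (card T) + 1) * mean (Suc n) (\<lambda>x. (g x)\<^sup>2))"
  proof (rule mult_mono)
    have "(\<Sum>x\<in>?A. (sqrt (?a x) - sqrt (?m x))\<^sup>2) \<le> real (card T)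
        * avg (\<lambda>t. \<Sum>x\<in>?A. (sqrt (law n (inv t \<otimes> x)) - sqrt (?m x))\<^sup>2)"
      using s by (intro le_card_avg) (simp_all add: sum_nonneg del: word_ball.simps)
    also have "\<dots> \<le> real (card T) * (entropy (Suc n) - entropy n)"
      by (intro mult_left_mono entropy_increment) simp
    finally show "(\<Sum>x\<in>?A. (sqrt (?a x) - sqrt (?m x))\<^sup>2)
        \<le> real (card T) * (entropy (Suc n) - entropy n)" .
    then show "0 \<le> real (card T) * (entropy (Suc n) - entropy n)"
      by (rule order_trans[rotated]) (simp add: sum_nonneg)
    have "((sqrt (?a x) + sqrt (?m x)) * g x)\<^sup>2 \<le> 2 * (real (card T) + 1) * (?m x * (g x)\<^sup>2)"
      if "x \<in> ?A" for x
    proof -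
      have "0 \<le> (sqrt (?a x) - sqrt (?m x))\<^sup>2" by simp
      then have "(sqrt (?a x) + sqrt (?m x))\<^sup>2 \<le> 2 * (?a x + ?m x)"
        by (simp add: power2_sum power2_diff law_nonneg)
      also have "\<dots> \<le> 2 * (real (card T) + 1) * ?m x"
        using law_translate_le[OF s ball_carrier[OF that], of n] by (simp add: algebra_simps)
      finally have "(sqrt (?a x) + sqrt (?m x))\<^sup>2 * (g x)\<^sup>2 \<le> 2 * (real (card T) + 1) * ?m x * (g x)\<^sup>2"
        by (rule mult_right_mono) simp
      then show ?thesis by (simp add: power_mult_distrib mult.assoc)
    qed
    then show "(\<Sum>x\<in>?A. ((sqrt (?a x) + sqrt (?m x)) * g x)\<^sup>2)
        \<le> 2 * (real (card T) + 1) * mean (Suc n) (\<lambda>x. (g x)\<^sup>2)"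
      unfolding mean_eq_sum[OF finite_ball order_refl] sum_distrib_left by (intro sum_mono)
    show "0 \<le> (\<Sum>x\<in>?A. ((sqrt (?a x) + sqrt (?m x)) * g x)\<^sup>2)" by (simp add: sum_nonneg)
  qed
  finally show ?thesis .
qed

lemma walk_harmonic_vanishes_on_generators:
  assumes growth: "\<And>n. n \<ge> 1 \<Longrightarrow> real (card (wball n)) \<le> C * real n ^ d"
    and g: "walk_harmonic g" and g1: "g \<one> = 0"
    and vanish: "\<And>\<delta>. \<delta> > 0 \<Longrightarrow> finite {x \<in> carrier G. energy g x > \<delta>}"
    and s: "s \<in> T"
  shows "g s = 0"
proof (rule ccontr)
  assume "g s \<noteq> 0"
  then have q: "(g s)\<^sup>2 > 0" by simp
  \<comment> \<open>\<open>K\<close> collects the constants, so that a second moment below \<open>(g s)\<^sup>2 / (2 K) * n\<close> yields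
    \<open>(g s)\<^sup>2 \<le> (g s)\<^sup>2 / 2\<close>.\<close>
  define K where "K = real (card T) * real (Suc d) * (2 * (real (card T) + 1))"
  have K: "K > 0" unfolding K_def using T_nonempty by simp
  obtain N where N: "\<And>n. n \<ge> N \<Longrightarrow> mean n (\<lambda>x. (g x)\<^sup>2) \<le> ((g s)\<^sup>2 / (2 * K)) * real n"
    using second_moment_sublinear[OF g g1 vanish, of "(g s)\<^sup>2 / (2 * K)"] q K by auto
  obtain n where n: "n \<ge> N" and small: "entropy (Suc n) - entropy n \<le> real (Suc d) / real (Suc n)"
    using small_entropy_increments[OF growth] by blast
  have "(g s)\<^sup>2 \<le> (real (card T) * (entropy (Suc n) - entropy n))
    * (2 * (real (card T) + 1) * mean (Suc n) (\<lambda>x. (g x)\<^sup>2))"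
    by (rule increment_le_entropy_increment[OF g g1 s])
  also have "\<dots> \<le> (real (card T) * (real (Suc d) / real (Suc n)))
    * (2 * (real (card T) + 1) * ((g s)\<^sup>2 / (2 * K) * real (Suc n)))"
    using mean_mono[of "Suc n" "\<lambda>_. 0" "\<lambda>x. (g x)\<^sup>2"] N[of "Suc n"] n small
    by (intro mult_mono mult_left_mono mult_nonneg_nonneg)
       (simp_all add: mean_const del: mean.simps word_ball.simps)
  also have "\<dots> = K * ((g s)\<^sup>2 / (2 * K))"
  proof -
    have cancel: "(a * (b / k)) * (c * (X * k)) = (a * b * c) * X" if "k \<noteq> 0" for a b c k X :: real
      using that by simp
    show ?thesis unfolding K_def by (rule cancel) simp
  qed
  also have "\<dots> = (g s)\<^sup>2 / 2" using K by simp
  finally show False using q by simp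
qed

lemma walk_harmonic_constant:
  assumes growth: "\<And>n. n \<ge> 1 \<Longrightarrow> real (card (wball n)) \<le> C * real n ^ d"
    and f: "walk_harmonic f"
    and vanish: "\<And>\<delta>. \<delta> > 0 \<Longrightarrow> finite {x \<in> carrier G. energy f x > \<delta>}"
  shows "f constant_on carrier G"
proof -
  have step: "f (x \<otimes> t) = f x" if x: "x \<in> carrier G" and t: "t \<in> T" for x t
  proof -
    define g where "g = (\<lambda>y. f (x \<otimes> y) - f x)"
    have "energy g y = energy f (x \<otimes> y)" if "y \<in> carrier G" for y
      unfolding energy_def g_def using x that by (intro avg_cong) (simp add: m_assoc)
    then have "y \<in> (\<lambda>z. inv x \<otimes> z) ` {z \<in> carrier G. energy f z > \<delta>}"
      if "y \<in> carrier G" "energy g y > \<delta>" for y \<delta>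
      using x that by (intro image_eqI[where x = "x \<otimes> y"]) (simp_all add: m_assoc[symmetric])
    then have sub: "{y \<in> carrier G. energy g y > \<delta>}
        \<subseteq> (\<lambda>z. inv x \<otimes> z) ` {z \<in> carrier G. energy f z > \<delta>}" for \<delta>
      by (intro subsetI) (elim CollectE conjE)
    have fin: "finite {y \<in> carrier G. energy g y > \<delta>}" if "\<delta> > 0" for \<delta>
      by (rule finite_subset[OF sub]) (intro finite_imageI vanish that)
    have "g \<one> = 0" using x by (simp add: g_def)
    moreover have "walk_harmonic g"
      unfolding g_def by (rule walk_harmonic_translate[OF f x])
    ultimately have "g t = 0"
      by (intro walk_harmonic_vanishes_on_generators[OF growth _ _ fin t])
    then show ?thesis by (simp add: g_def)
  qed
  have "f (y \<otimes> x) = f y" if "x \<in> generate G S" "y \<in> carrier G" for x y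
    using that
  proof (induction arbitrary: y)
    case (eng h1 h2)
    then have "h1 \<in> carrier G" "h2 \<in> carrier G" using generate_S by auto
    then show ?case using eng by (simp add: m_assoc[symmetric])
  qed (auto simp: step symmetrized_def)
  then have "f x = f \<one>" if "x \<in> carrier G" for x
    using that generate_S by (metis l_one one_closed)
  then show ?thesis unfolding constant_on_def by blast
qed

section \<open>Harmonic functions on the Cayley graph\<close>

lemma cayley_edges_iff:
  assumes "x \<in> carrier G"
  shows "(x, y) \<in> cayley_edges G S \<longleftrightarrow> (\<exists>t\<in>T. y = x \<otimes> t)"
proof
  assume "(x, y) \<in> cayley_edges G S"
  then have "y = x \<otimes> (inv x \<otimes> y)" "inv x \<otimes> y \<in> T"
    using assms by (auto simp: cayley_edges_def m_assoc[symmetric])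
  then show "\<exists>t\<in>T. y = x \<otimes> t" by blast
qed (use assms in \<open>auto simp: cayley_edges_def m_assoc[symmetric]\<close>)

lemma harmonic_imp_walk_harmonic:
  assumes "harmonic (carrier G) (cayley_edges G S) f"
  shows "walk_harmonic f"
  unfolding walk_harmonic_def
proof
  fix x assume x: "x \<in> carrier G"
  have N: "{y. (z, y) \<in> cayley_edges G S} = (\<lambda>t. z \<otimes> t) ` T" if "z \<in> carrier G" for z
    using cayley_edges_iff[OF that] by auto
  have "{y. (z, y) \<in> cayley_edges G S} \<noteq> {}" if "z \<in> carrier G" for z
    using N[OF that] T_nonempty by simp
  then have "f x = (\<Sum>y | (x, y) \<in> cayley_edges G S. f y) / card {y. (x, y) \<in> cayley_edges G S}"
    using assms x harmonic_iff_average[OF sym_cayley_edges[OF S_carrier]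
        finite_cayley_neighbours[OF finite_S], of "carrier G" f] by blast
  moreover have "inj_on (\<lambda>t. x \<otimes> t) T" using x by (auto simp: inj_on_def)
  ultimately show "avg (\<lambda>t. f (x \<otimes> t)) = f x"
    by (simp add: N[OF x] avg_def sum.reindex card_image)
qed

lemma c0_gradient_imp_energy_vanishes:
  assumes c0: "gradient f \<in> c0 (cayley_edges G S)" and d: "\<delta> > 0"
  shows "finite {x \<in> carrier G. energy f x > \<delta>}"
proof -
  obtain F where F: "finite F"
    and small: "linf_norm (cayley_edges G S - F) (gradient f) < ennreal (sqrt \<delta>)"
    using c0 d unfolding c0_def by (blast dest: real_sqrt_gt_zero)
  have "energy f x \<le> \<delta>" if x: "x \<in> carrier G" "x \<notin> fst ` F" for x
  proof -
    have "(f (x \<otimes> t) - f x)\<^sup>2 \<le> \<delta>" if t: "t \<in> T" for t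
    proof -
      have "(x, x \<otimes> t) \<in> cayley_edges G S - F"
        using x t cayley_edges_iff[OF x(1)] by force
      then have "ennreal \<bar>gradient f (x, x \<otimes> t)\<bar> \<le> linf_norm (cayley_edges G S - F) (gradient f)"
        unfolding linf_norm_def by (rule SUP_upper)
      with small have "ennreal \<bar>gradient f (x, x \<otimes> t)\<bar> < ennreal (sqrt \<delta>)" by (rule le_less_trans[rotated])
      then have "\<bar>f (x \<otimes> t) - f x\<bar> < sqrt \<delta>" by (simp add: ennreal_less_iff gradient_def)
      then have "\<bar>f (x \<otimes> t) - f x\<bar>\<^sup>2 \<le> (sqrt \<delta>)\<^sup>2" by (intro power_mono) simp_all
      then show ?thesis using d by simp
    qed
    then have "energy f x \<le> avg (\<lambda>t. \<delta>)" unfolding energy_def by (rule avg_mono)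
    then show ?thesis by (simp add: avg_const)
  qed
  then have "{x \<in> carrier G. energy f x > \<delta>} \<subseteq> fst ` F" by force
  then show ?thesis using F finite_surj by blast
qed

end

theorem lemma5:
  fixes H (structure) and S :: "'a set" and f :: "'a \<Rightarrow> real"
  assumes "group H"
    and "polynomial_growth H"
    and "finite_generating_set H S"
    and "harmonic (carrier H) (cayley_edges H S) f"
    and "gradient f \<in> c0 (cayley_edges H S)"
  shows "f constant_on carrier H"
proof (cases "S = {}")
  \<comment> \<open>Without generators there are no steps to average over, but then the group is trivial.\<close>
  case True
  have "carrier H = {\<one>}"
    using assms(3) group.generate_empty[OF assms(1)] by (simp add: finite_generating_set_def True)
  then show ?thesis by (simp add: constant_on_def)
next
  case False
  interpret cayley_walk H S
    by (intro cayley_walk.intro cayley_walk_axioms.intro assms(1,3) False)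
  obtain C :: real and d :: nat where "\<forall>n\<ge>1. real (card (word_ball H S n)) \<le> C * real n ^ d"
    using polynomial_growth_word_ball[OF assms(2,3)] by blast
  then show ?thesis
    using harmonic_imp_walk_harmonic[OF assms(4)] c0_gradient_imp_energy_vanishes[OF assms(5)]
    by (intro walk_harmonic_constant) auto
qed

end
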